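(* $\mathfrak{p}=\mathfrak{p}_{wt}$ (see context for both cardinals).
   Context: $[\mathbb{N}]^{\infty}$ denotes the family of all infinite subsets of $\mathbb{N}$. For $A,B\subseteq\mathbb{N}$, $A\subseteq^* B$ means $A\setminus B$ is finite. A family $\mathcal{F}\subseteq[\mathbb{N}]^\infty$ is centered if the intersection of every nonempty finite subfamily of $\mathcal{F}$ is infinite. An infinite $A\subseteq\mathbb{N}$ is a pseudo-intersection of $\mathcal{F}$ if $A\subseteq^* B$ for all $B\in\mathcal{F}$. $\mathfrak{p}$ is the minimal size of a centered family $\mathcal{F}\subseteq[\mathbb{N}]^\infty$ with no pseudo-intersection. For $\mathcal{F}\subseteq[\mathbb{N}]^\infty$ and infinite $A\subseteq\mathbb{N}$, let $\mathcal{F}\|A=\{B\cap A: B\in\mathcal{F}\}$; this restriction is called large if all its members are infinite. $\mathfrak{p}_{wt}$ is the minimal cardinality of a centered family $\mathcal{F}\subseteq[\mathbb{N}]^\infty$ such that there is no infinite $A\subseteq\mathbb{N}$ for which $\mathcal{F}\|A$ is large and linearly quasiordered by $\subseteq^*$. *)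

theory Defs
  imports "HOL-Library.Infinite_Set"
begin

unbundle cardinal_syntax

definition almost_subset :: "nat set \<Rightarrow> nat set \<Rightarrow> bool"  (infix "\<subseteq>*" 50) where
  "A \<subseteq>* B \<longleftrightarrow> finite (A - B)"

definition centered :: "nat set set \<Rightarrow> bool" where
  "centered F \<longleftrightarrow> (\<forall>A\<in>F. infinite A) \<and>
    (\<forall>G. G \<subseteq> F \<and> finite G \<and> G \<noteq> {} \<longrightarrow> infinite (\<Inter>G))"

definition pseudo_intersection :: "nat set \<Rightarrow> nat set set \<Rightarrow> bool" where
  "pseudo_intersection A F \<longleftrightarrow> infinite A \<and> (\<forall>B\<in>F. A \<subseteq>* B)"

definition restriction :: "nat set set \<Rightarrow> nat set \<Rightarrow> nat set set"  (infixl "\<parallel>" 65) where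
  "F \<parallel> A = {B \<inter> A | B. B \<in> F}"

definition large :: "nat set set \<Rightarrow> bool" where
  "large G \<longleftrightarrow> (\<forall>B\<in>G. infinite B)"

definition linearly_quasiordered_on :: "'a set \<Rightarrow> ('a \<Rightarrow> 'a \<Rightarrow> bool) \<Rightarrow> bool" where
  "linearly_quasiordered_on G R \<longleftrightarrow> reflp_on G R \<and> transp_on G R \<and> totalp_on G R"

text \<open>The minimal cardinality of a member of a collection \<open>P\<close> of sets. As usual in HOL, a cardinal
  is represented by a cardinal well-order, which is determined only up to \<open>=o\<close>; equality of
  cardinals is therefore \<open>=o\<close>. The value is meaningful only for nonempty \<open>P\<close>.\<close>

definition min_card :: "'a set set \<Rightarrow> 'a rel" where
  "min_card P = (SOME r. (\<exists>F\<in>P. r = |F| ) \<and> (\<forall>F\<in>P. r \<le>o |F| ))"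

definition p_families :: "nat set set set" where
  "p_families = {F. centered F \<and> \<not> (\<exists>A. pseudo_intersection A F)}"

definition p_wt_families :: "nat set set set" where
  "p_wt_families = {F. centered F \<and>
    \<not> (\<exists>A. infinite A \<and> large (F \<parallel> A) \<and> linearly_quasiordered_on (F \<parallel> A) (\<subseteq>*))}"

definition cardinal_p :: "nat set rel"  ("\<pp>") where
  "\<pp> = min_card p_families"

definition cardinal_p_wt :: "nat set rel"  ("\<pp>\<^sub>w\<^sub>t") where
  "\<pp>\<^sub>w\<^sub>t = min_card p_wt_families"

text \<open>Both cardinals are well defined: a maximal centered family belongs to both collections.\<close>

lemma min_card:
  assumes "P \<noteq> {}"
  shows "\<exists>F\<in>P. min_card P = |F|" and "\<And>F. F \<in> P \<Longrightarrow> min_card P \<le>o |F|"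
proof -
  have "\<exists>r \<in> card_of ` P. \<forall>r' \<in> card_of ` P. r \<le>o r'"
    using assms by (intro exists_minim_Card_order) (auto simp: card_of_Card_order)
  then have "\<exists>r. (\<exists>F\<in>P. r = |F| ) \<and> (\<forall>F\<in>P. r \<le>o |F| )" by blast
  then have *: "(\<exists>F\<in>P. min_card P = |F| ) \<and> (\<forall>F\<in>P. min_card P \<le>o |F| )"
    unfolding min_card_def by (rule someI_ex)
  show "\<exists>F\<in>P. min_card P = |F|" using * by blast
  show "min_card P \<le>o |F|" if "F \<in> P" for F using * that by blast
qed

lemma ex_centered_ultra: "\<exists>U. centered U \<and> (\<forall>A. A \<in> U \<or> - A \<in> U)"
proof -
  have "\<exists>M\<in>Collect centered. \<forall>X\<in>Collect centered. M \<subseteq> X \<longrightarrow> X = M"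
  proof (rule subset_Zorn')
    fix C assume C: "subset.chain (Collect centered) C"
    have "infinite (\<Inter>G)" if G: "G \<subseteq> \<Union>C" "finite G" "G \<noteq> {}" for G
    proof -
      have "C \<noteq> {}" using G by auto
      then obtain F where "F \<in> C" "G \<subseteq> F"
        using finite_subset_Union_chain[OF G(2,1)] C by blast
      moreover have "centered F" using C \<open>F \<in> C\<close> by (auto simp: subset.chain_def)
      ultimately show ?thesis using G by (auto simp: centered_def)
    qed
    moreover have "\<forall>A\<in>\<Union>C. infinite A" using C by (auto simp: subset.chain_def centered_def)
    ultimately show "\<Union>C \<in> Collect centered" by (simp add: centered_def)
  qed
  then obtain M where M: "centered M" and max: "\<And>X. centered X \<Longrightarrow> M \<subseteq> X \<Longrightarrow> X = M"
    by auto
  have inf: "infinite (\<Inter>G)" if "G \<subseteq> M" "finite G" for G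
    using M that by (cases "G = {}") (auto simp: centered_def)
  have ex: "\<exists>G. G \<subseteq> M \<and> finite G \<and> finite (\<Inter>G \<inter> A)" if "A \<notin> M" for A
  proof (rule ccontr)
    assume *: "\<not> ?thesis"
    have "infinite (\<Inter>H)" if H: "H \<subseteq> insert A M" "finite H" for H
    proof
      assume "finite (\<Inter>H)"
      moreover have "\<Inter>(H - {A}) \<inter> A \<subseteq> \<Inter>H" by blast
      ultimately have "finite (\<Inter>(H - {A}) \<inter> A)" by (rule finite_subset[rotated])
      moreover have "H - {A} \<subseteq> M" "finite (H - {A})" using H by auto
      ultimately show False using * by (metis (no_types))
    qed
    moreover from this[of "{A}"] have "infinite A" by simp
    ultimately have "centered (insert A M)" using M by (simp add: centered_def)
    then show False using max[of "insert A M"] that by blast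
  qed
  have "A \<in> M \<or> - A \<in> M" for A
  proof (rule ccontr)
    assume "\<not> ?thesis"
    then obtain G H where G: "G \<subseteq> M" "finite G" "finite (\<Inter>G \<inter> A)"
      and H: "H \<subseteq> M" "finite H" "finite (\<Inter>H \<inter> - A)" using ex[of A] ex[of "- A"] by auto
    have "\<Inter>(G \<union> H) \<subseteq> (\<Inter>G \<inter> A) \<union> (\<Inter>H \<inter> - A)" by blast
    then have "finite (\<Inter>(G \<union> H))" using G(3) H(3) by (meson finite_Un finite_subset)
    then show False using inf[of "G \<union> H"] G H by simp
  qed
  then show ?thesis using M by blast
qed

lemma p_families_nonempty: "p_families \<noteq> {}"
proof -
  obtain U where U: "centered U" "\<And>A. A \<in> U \<or> - A \<in> U" using ex_centered_ultra by blast
  have "\<not> pseudo_intersection A U" for A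
  proof
    assume A: "pseudo_intersection A U"
    then obtain B C where BC: "B \<subseteq> A" "C \<subseteq> A" "infinite B" "infinite C" "B \<inter> C = {}"
      using A unfolding pseudo_intersection_def by (auto elim: infinite_split)
    have "C \<subseteq> A - B" "B \<subseteq> A - (- B)" using BC by auto
    then have "\<not> A \<subseteq>* B" "\<not> A \<subseteq>* - B"
      using BC(3,4) unfolding almost_subset_def by (blast dest: finite_subset)+
    then show False using A U(2)[of B] unfolding pseudo_intersection_def by blast
  qed
  then show ?thesis using U by (auto simp: p_families_def)
qed

lemma p_wt_families_nonempty: "p_wt_families \<noteq> {}"
proof -
  obtain U where U: "centered U" "\<And>A. A \<in> U \<or> - A \<in> U" using ex_centered_ultra by blast
  have "\<not> linearly_quasiordered_on (U \<parallel> A) (\<subseteq>*)" if A: "infinite A" "large (U \<parallel> A)" for A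
  proof
    assume lin: "linearly_quasiordered_on (U \<parallel> A) (\<subseteq>*)"
    have comp: "finite ((X - Y) \<inter> A) \<or> finite ((Y - X) \<inter> A)" if XY: "X \<in> U" "Y \<in> U" for X Y
    proof (cases "X \<inter> A = Y \<inter> A")
      case True
      then have "(X - Y) \<inter> A = {}" by blast
      then show ?thesis by simp
    next
      case False
      have "X \<inter> A \<in> U \<parallel> A" "Y \<inter> A \<in> U \<parallel> A" using XY by (auto simp: restriction_def)
      then have "X \<inter> A \<subseteq>* Y \<inter> A \<or> Y \<inter> A \<subseteq>* X \<inter> A"
        using lin False by (auto simp: linearly_quasiordered_on_def totalp_on_def)
      moreover have "X \<inter> A - Y \<inter> A = (X - Y) \<inter> A" "Y \<inter> A - X \<inter> A = (Y - X) \<inter> A" by blast+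
      ultimately show ?thesis by (simp add: almost_subset_def)
    qed
    have incomp: "\<not> (X \<in> U \<and> Y \<in> U)"
      if "infinite K" "K \<subseteq> (X - Y) \<inter> A" "infinite L" "L \<subseteq> (Y - X) \<inter> A" for X Y K L
      using comp[of X Y] finite_subset[OF that(2)] finite_subset[OF that(4)] that(1,3) by blast
    obtain P Q where PQ: "P \<subseteq> A" "Q \<subseteq> A" "infinite P" "infinite Q" "P \<inter> Q = {}"
      by (rule infinite_split[OF A(1)])
    obtain R S where RS: "R \<subseteq> P" "S \<subseteq> P" "infinite R" "infinite S" "R \<inter> S = {}"
      by (rule infinite_split[OF PQ(3)])
    obtain T V where TV: "T \<subseteq> Q" "V \<subseteq> Q" "infinite T" "infinite V" "T \<inter> V = {}"
      by (rule infinite_split[OF PQ(4)])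
    note parts = PQ(1,2,5) RS(1,2,5) TV(1,2,5)
    have "\<not> (P \<in> U \<and> R \<union> T \<in> U)"
      by (rule incomp[OF RS(4) _ TV(3)]) (use parts in auto)
    moreover have "\<not> (P \<in> U \<and> - (R \<union> T) \<in> U)"
      by (rule incomp[OF RS(3) _ TV(4)]) (use parts in auto)
    moreover have "\<not> (- P \<in> U \<and> R \<union> T \<in> U)"
      by (rule incomp[OF TV(4) _ RS(3)]) (use parts in auto)
    moreover have "\<not> (- P \<in> U \<and> - (R \<union> T) \<in> U)"
      by (rule incomp[OF TV(3) _ RS(4)]) (use parts in auto)
    ultimately show False using U(2)[of P] U(2)[of "R \<union> T"] by blast
  qed
  then show ?thesis using U by (auto simp: p_wt_families_def)
qed

end

(* If F is centered without pseudo-intersection, so is G = F Un {-X Un Y | X, Y : F}, and |G| = |F|.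
   Suppose that G restricted to A is large and linear. Some X : F does not almost contain A, so
   (-X Un Y) Int A is never almost contained in X Int A; linearity yields X Int A <=* Y for all Y : F,
   and X Int A is a pseudo-intersection of F. *)

theory Submission
  imports Defs
begin

text \<open>Each trace \<open>B \<inter> A\<close> is cofinite in \<open>A\<close>, so any two
  traces almost contain each other and the quasiorder is linear in a degenerate way.\<close>

lemma pseudo_intersection_restriction:
  assumes "pseudo_intersection A F"
  shows "large (F \<parallel> A)" and "linearly_quasiordered_on (F \<parallel> A) (\<subseteq>*)"
proof -
  have fin: "finite (A - B)" if "B \<in> F" for B
    using assms that by (simp add: pseudo_intersection_def almost_subset_def)
  have "infinite (B \<inter> A)" if "B \<in> F" for B
  proof
    assume "finite (B \<inter> A)"
    then have "finite ((A - B) \<union> B \<inter> A)" using fin that by simp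
    moreover have "(A - B) \<union> B \<inter> A = A" by blast
    ultimately show False using assms by (simp add: pseudo_intersection_def)
  qed
  then show "large (F \<parallel> A)" by (auto simp: large_def restriction_def)
  have "X \<subseteq>* Y" if XY: "X \<in> F \<parallel> A" "Y \<in> F \<parallel> A" for X Y
  proof -
    obtain B where "B \<in> F" "Y = B \<inter> A" using XY by (auto simp: restriction_def)
    moreover have "X \<subseteq> A" using XY by (auto simp: restriction_def)
    ultimately have "X - Y \<subseteq> A - B" "finite (A - B)" using fin by auto
    then show ?thesis unfolding almost_subset_def by (rule finite_subset)
  qed
  then show "linearly_quasiordered_on (F \<parallel> A) (\<subseteq>*)"
    by (auto simp: linearly_quasiordered_on_def reflp_on_def transp_on_def totalp_on_def)
qed

text \<open>A pseudo-intersection already serves as the set \<open>A\<close> that membership in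
  \<open>p_wt_families\<close> forbids. This inclusion yields
  \<open>\<pp> \<le>o \<pp>\<^sub>w\<^sub>t\<close>.\<close>

lemma p_wt_families_subset: "p_wt_families \<subseteq> p_families"
proof -
  have "infinite A" if "pseudo_intersection A F" for A F
    using that by (simp add: pseudo_intersection_def)
  then show ?thesis
    using pseudo_intersection_restriction unfolding p_wt_families_def p_families_def by blast
qed

text \<open>Choosing a member of \<open>F\<close> below each set of a finite \<open>H\<close> gives
  a finite subfamily of \<open>F\<close> whose intersection lies inside
  \<open>\<Inter>H\<close>.\<close>

lemma centered_finer:
  assumes F: "centered F" and G: "\<And>B. B \<in> G \<Longrightarrow> \<exists>C\<in>F. C \<subseteq> B"
  shows "centered G"
proof -
  obtain c where c: "\<And>B. B \<in> G \<Longrightarrow> c B \<in> F \<and> c B \<subseteq> B" using G by metis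
  have inf: "infinite (\<Inter>H)" if H: "H \<subseteq> G" "finite H" "H \<noteq> {}" for H
  proof -
    have "c ` H \<subseteq> F" using H(1) c by blast
    then have "infinite (\<Inter>(c ` H))" using F H(2,3) by (simp add: centered_def)
    moreover have "\<Inter>(c ` H) \<subseteq> \<Inter>H" using H(1) c by blast
    ultimately show ?thesis by (blast dest: finite_subset)
  qed
  have "infinite B" if "B \<in> G" for B using inf[of "{B}"] that by simp
  then show ?thesis using inf by (simp add: centered_def)
qed

text \<open>A finite centered family has its own intersection as a pseudo-intersection. Infinity is
  what makes \<open>F \<times> F\<close> no larger than \<open>F\<close> later on.\<close>

lemma p_families_infinite:
  assumes "F \<in> p_families"
  shows "infinite F"
proof
  assume fin: "finite F"
  have "infinite (\<Inter>F)"
    \<comment> \<open>Centeredness speaks of nonempty subfamilies only; for empty \<open>F\<close>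
      the intersection is all of the natural numbers.\<close>
    using assms fin by (cases "F = {}") (auto simp: p_families_def centered_def)
  moreover have "\<Inter>F \<subseteq>* B" if "B \<in> F" for B
    using that by (metis Diff_eq_empty_iff Inf_lower almost_subset_def finite.emptyI)
  ultimately have "pseudo_intersection (\<Inter>F) F" by (simp add: pseudo_intersection_def)
  then show False using assms by (auto simp: p_families_def)
qed

text \<open>The set \<open>- X \<union> Y\<close> is the Boolean implication from \<open>X\<close>
  to \<open>Y\<close>: it contains everything outside \<open>X\<close> and agrees with
  \<open>Y\<close> inside \<open>X\<close>.\<close>

definition implication_closure :: "nat set set \<Rightarrow> nat set set" where
  "implication_closure F = F \<union> (\<lambda>(X, Y). - X \<union> Y) ` (F \<times> F)"

lemma card_of_implication_closure:
  assumes "infinite F"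
  shows "|implication_closure F| \<le>o |F|"
proof -
  have "|F \<times> F| \<le>o |F|" using card_of_Times_same_infinite[OF assms] ordIso_imp_ordLeq by blast
  then have "|(\<lambda>(X, Y). - X \<union> Y) ` (F \<times> F)| \<le>o |F|" using card_of_image ordLeq_transitive by blast
  then have "|F <+> (\<lambda>(X, Y). - X \<union> Y) ` (F \<times> F)| =o |F|"
    by (rule card_of_Plus_infinite1[OF assms])
  then show ?thesis unfolding implication_closure_def
    by (rule ordLeq_ordIso_trans[OF card_of_Un_Plus_ordLeq])
qed

lemma implication_closure_p_wt:
  assumes "F \<in> p_families"
  shows "implication_closure F \<in> p_wt_families"
proof -
  let ?G = "implication_closure F"
  have F: "centered F" and no: "\<And>A. \<not> pseudo_intersection A F"
    using assms by (auto simp: p_families_def)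
  have "centered ?G"
    \<comment> \<open>Each \<open>X\<close> lies below itself, and \<open>Y\<close> lies below
      \<open>- X \<union> Y\<close>.\<close>
    by (rule centered_finer[OF F]) (auto simp: implication_closure_def)
  moreover have False if A: "infinite A" "large (?G \<parallel> A)"
    and lin: "linearly_quasiordered_on (?G \<parallel> A) (\<subseteq>*)" for A
  proof -
    \<comment> \<open>This \<open>X\<close> is fixed before \<open>Y\<close> varies, so that the
      single set \<open>X \<inter> A\<close> works for every \<open>Y\<close>.\<close>
    obtain X where X: "X \<in> F" "infinite (A - X)"
      using no[of A] A(1) by (auto simp: pseudo_intersection_def almost_subset_def)
    have XG: "X \<inter> A \<in> ?G \<parallel> A"
      using X(1) by (auto simp: restriction_def implication_closure_def)
    have "X \<inter> A \<subseteq>* Y" if Y: "Y \<in> F" for Y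
    proof -
      let ?Z = "(- X \<union> Y) \<inter> A"
      have "?Z \<in> ?G \<parallel> A"
        using X(1) Y by (auto simp: restriction_def implication_closure_def)
      moreover have "A - X \<subseteq> ?Z - X \<inter> A" by blast
      then have "\<not> ?Z \<subseteq>* X \<inter> A"
        using X(2) finite_subset unfolding almost_subset_def by blast
      \<comment> \<open>Totality compares distinct sets only; reflexivity covers the case that
        \<open>?Z\<close> equals \<open>X \<inter> A\<close>.\<close>
      ultimately have "X \<inter> A \<subseteq>* ?Z"
        using lin XG unfolding linearly_quasiordered_on_def totalp_on_def reflp_on_def by metis
      moreover have "X \<inter> A - ?Z = X \<inter> A - Y" by blast
      ultimately show ?thesis by (simp add: almost_subset_def)
    qed
    moreover have "infinite (X \<inter> A)" using A(2) XG by (simp add: large_def)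
    ultimately show False using no by (auto simp: pseudo_intersection_def)
  qed
  ultimately show ?thesis by (auto simp: p_wt_families_def)
qed

theorem theorem2p1:
  shows "\<pp> =o \<pp>\<^sub>w\<^sub>t"
proof -
  obtain F where F: "F \<in> p_families" "\<pp> = |F|"
    using min_card(1)[OF p_families_nonempty] by (auto simp: cardinal_p_def)
  have "\<pp>\<^sub>w\<^sub>t \<le>o |implication_closure F|"
    using min_card(2)[OF p_wt_families_nonempty implication_closure_p_wt[OF F(1)]]
    by (simp add: cardinal_p_wt_def)
  then have "\<pp>\<^sub>w\<^sub>t \<le>o \<pp>"
    using card_of_implication_closure[OF p_families_infinite[OF F(1)]] F(2) ordLeq_transitive
    by metis
  \<comment> \<open>A smallest member of \<open>p_wt_families\<close> also competes in the minimum
    that defines \<open>\<pp>\<close>.\<close>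
  moreover have "\<pp> \<le>o \<pp>\<^sub>w\<^sub>t"
    using min_card(1)[OF p_wt_families_nonempty] min_card(2)[OF p_families_nonempty]
      p_wt_families_subset
    by (force simp: cardinal_p_def cardinal_p_wt_def)
  ultimately show ?thesis by (simp add: ordIso_iff_ordLeq)
qed

end
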